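(* Let $P=([n],\preceq)$ be a poset, $w$ a weight on $\mathbb{F}_q$, $\pi(i)=k_i$ a label map with $N=\sum_ik_i$, and $\mathbb{C}\subseteq\mathbb{F}_q^N$ a code with $|\mathbb{C}|\ge2$. If $\mathbb{C}$ is MDS with respect to the $(P,w,\pi)$-metric, then $\mathbb{C}$ is MDS with respect to the $(P,\pi)$-metric.
   Context: A weight on $\mathbb{F}_q$ is a map $w:\mathbb{F}_q\to\mathbb{N}\cup\{0\}$ with $w(\alpha)=0$ iff $\alpha=0$, $w(-\alpha)=w(\alpha)$, $w(\alpha+\beta)\le w(\alpha)+w(\beta)$; $M_w=\max_\alpha w(\alpha)$; $\tilde w^k(v)=\max_s w(v_s)$. Ideals of $P$ are down-closed subsets; $\langle A\rangle$ is the generated ideal; $\mathcal{I}^r$ is the set of ideals of cardinality $r$. For $x=x_1\oplus\cdots\oplus x_n\in\mathbb{F}_q^{k_1}\oplus\cdots\oplus\mathbb{F}_q^{k_n}$, $supp_\pi(x)=\{i:x_i\ne0\}$, $I_x=\langle supp_\pi(x)\rangle$, $M_x$ its maximal elements, $w_{(P,w,\pi)}(x)=\sum_{i\in M_x}\tilde w^{k_i}(x_i)+|I_x\setminus M_x|\,M_w$, $w_{(P,\pi)}(x)=|I_x|$; the metrics are $d(x,y)=$ weight of $x-y$, and $d_{(P,w,\pi)}(\mathbb{C})$, $d_{(P,\pi)}(\mathbb{C})$ are minimum distances between distinct codewords. $\mathbb{C}$ is MDS w.r.t. the $(P,w,\pi)$-metric if $\max_{J\in\mathcal{I}^r}\{\sum_{i\in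 J}k_i\}=N-\lceil\log_q|\mathbb{C}|\rceil$ with $r=\lfloor(d_{(P,w,\pi)}(\mathbb{C})-1)/M_w\rfloor$, and MDS w.r.t. the $(P,\pi)$-metric if $\max_{J\in\mathcal{I}^{s}}\{\sum_{i\in J}k_i\}=N-\lceil\log_q|\mathbb{C}|\rceil$ with $s=d_{(P,\pi)}(\mathbb{C})-1$ (in each case the left side is always at most the right side). *)

theory Defs
  imports Complex_Main "HOL-Library.FuncSet" "HOL-Library.Cardinality" "Jordan_Normal_Form.Matrix"
begin

text \<open>The field with \<open>q\<close> elements is a type \<open>'a :: {field, finite}\<close> with \<open>q = CARD('a)\<close>. The poset
  on \<open>{1..n}\<close> is a relation \<open>P\<close> with \<open>partial_order_on {1..n} P\<close>, where \<open>(i, j) \<in> P\<close> means that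
  \<open>i\<close> precedes or equals \<open>j\<close>.\<close>

definition is_weight :: "('a :: {field, finite} \<Rightarrow> nat) \<Rightarrow> bool" where
  "is_weight w \<longleftrightarrow>
     (\<forall>a. w a = 0 \<longleftrightarrow> a = 0) \<and> (\<forall>a. w (- a) = w a) \<and> (\<forall>a b. w (a + b) \<le> w a + w b)"

definition max_weight :: "('a :: {field, finite} \<Rightarrow> nat) \<Rightarrow> nat" where
  "max_weight w = Max (range w)"

text \<open>Only meaningful for vectors of positive dimension.\<close>

definition block_weight :: "('a :: {field, finite} \<Rightarrow> nat) \<Rightarrow> 'a vec \<Rightarrow> nat" where
  "block_weight w v = Max ((\<lambda>s. w (v $ s)) ` {..<dim_vec v})"

definition poset_ideal :: "nat \<Rightarrow> (nat \<times> nat) set \<Rightarrow> nat set \<Rightarrow> bool" where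
  "poset_ideal n P I \<longleftrightarrow> I \<subseteq> {1..n} \<and> (\<forall>j\<in>I. \<forall>i. (i, j) \<in> P \<longrightarrow> i \<in> I)"

definition ideals_of_card :: "nat \<Rightarrow> (nat \<times> nat) set \<Rightarrow> nat \<Rightarrow> nat set set" where
  "ideals_of_card n P r = {I. poset_ideal n P I \<and> card I = r}"

definition maximal_elements :: "(nat \<times> nat) set \<Rightarrow> nat set \<Rightarrow> nat set" where
  "maximal_elements P I = {i \<in> I. \<forall>j\<in>I. (i, j) \<in> P \<longrightarrow> j = i}"

text \<open>A vector of length \<open>N = k 1 + \<dots> + k n\<close> is represented by its block decomposition,
  the family of its blocks \<open>x i\<close> of length \<open>k i\<close>.\<close>

definition block_space :: "nat \<Rightarrow> (nat \<Rightarrow> nat) \<Rightarrow> (nat \<Rightarrow> 'a :: {field, finite} vec) set" where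
  "block_space n k = (\<Pi>\<^sub>E i\<in>{1..n}. carrier_vec (k i))"

definition block_diff ::
  "nat \<Rightarrow> (nat \<Rightarrow> 'a :: {field, finite} vec) \<Rightarrow> (nat \<Rightarrow> 'a vec) \<Rightarrow> (nat \<Rightarrow> 'a vec)" where
  "block_diff n x y = (\<lambda>i\<in>{1..n}. x i - y i)"

definition block_supp ::
  "nat \<Rightarrow> (nat \<Rightarrow> nat) \<Rightarrow> (nat \<Rightarrow> 'a :: {field, finite} vec) \<Rightarrow> nat set" where
  "block_supp n k x = {i \<in> {1..n}. x i \<noteq> 0\<^sub>v (k i)}"

text \<open>The hull is the smallest ideal containing the support, i.e. the ideal it generates.\<close>

definition supp_ideal ::
  "nat \<Rightarrow> (nat \<times> nat) set \<Rightarrow> (nat \<Rightarrow> nat) \<Rightarrow> (nat \<Rightarrow> 'a :: {field, finite} vec) \<Rightarrow> nat set" where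
  "supp_ideal n P k x = poset_ideal n P hull block_supp n k x"

definition pwpi_weight ::
  "nat \<Rightarrow> (nat \<times> nat) set \<Rightarrow> ('a :: {field, finite} \<Rightarrow> nat) \<Rightarrow> (nat \<Rightarrow> nat) \<Rightarrow>
     (nat \<Rightarrow> 'a vec) \<Rightarrow> nat" where
  "pwpi_weight n P w k x =
     (let I = supp_ideal n P k x; M = maximal_elements P I
      in (\<Sum>i\<in>M. block_weight w (x i)) + card (I - M) * max_weight w)"

definition ppi_weight ::
  "nat \<Rightarrow> (nat \<times> nat) set \<Rightarrow> (nat \<Rightarrow> nat) \<Rightarrow> (nat \<Rightarrow> 'a :: {field, finite} vec) \<Rightarrow> nat" where
  "ppi_weight n P k x = card (supp_ideal n P k x)"

definition pwpi_dist ::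
  "nat \<Rightarrow> (nat \<times> nat) set \<Rightarrow> ('a :: {field, finite} \<Rightarrow> nat) \<Rightarrow> (nat \<Rightarrow> nat) \<Rightarrow>
     (nat \<Rightarrow> 'a vec) \<Rightarrow> (nat \<Rightarrow> 'a vec) \<Rightarrow> nat" where
  "pwpi_dist n P w k x y = pwpi_weight n P w k (block_diff n x y)"

definition ppi_dist ::
  "nat \<Rightarrow> (nat \<times> nat) set \<Rightarrow> (nat \<Rightarrow> nat) \<Rightarrow>
     (nat \<Rightarrow> 'a :: {field, finite} vec) \<Rightarrow> (nat \<Rightarrow> 'a vec) \<Rightarrow> nat" where
  "ppi_dist n P k x y = ppi_weight n P k (block_diff n x y)"

text \<open>Only meaningful for finite codes with at least two codewords.\<close>

definition min_dist :: "('c \<Rightarrow> 'c \<Rightarrow> nat) \<Rightarrow> 'c set \<Rightarrow> nat" where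
  "min_dist d C = Min {d x y | x y. x \<in> C \<and> y \<in> C \<and> x \<noteq> y}"

text \<open>The common part of the two MDS conditions: equality in the Singleton-type bound for ideals
  of cardinality \<open>r\<close>.\<close>

definition singleton_equality ::
  "nat \<Rightarrow> (nat \<times> nat) set \<Rightarrow> (nat \<Rightarrow> nat) \<Rightarrow> nat \<Rightarrow> (nat \<Rightarrow> 'a :: {field, finite} vec) set \<Rightarrow> bool"
  where
  "singleton_equality n P k r C \<longleftrightarrow>
     int (Max ((\<lambda>J. \<Sum>i\<in>J. k i) ` ideals_of_card n P r))
       = int (\<Sum>i = 1..n. k i) - \<lceil>log (real CARD('a)) (real (card C))\<rceil>"

text \<open>For codes with at least two codewords both minimum distances are positive, so the
  subtractions below do not truncate.\<close>

definition pwpi_MDS ::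
  "nat \<Rightarrow> (nat \<times> nat) set \<Rightarrow> ('a :: {field, finite} \<Rightarrow> nat) \<Rightarrow> (nat \<Rightarrow> nat) \<Rightarrow>
     (nat \<Rightarrow> 'a vec) set \<Rightarrow> bool" where
  "pwpi_MDS n P w k C \<longleftrightarrow>
     singleton_equality n P k ((min_dist (pwpi_dist n P w k) C - 1) div max_weight w) C"

definition ppi_MDS ::
  "nat \<Rightarrow> (nat \<times> nat) set \<Rightarrow> (nat \<Rightarrow> nat) \<Rightarrow> (nat \<Rightarrow> 'a :: {field, finite} vec) set \<Rightarrow> bool" where
  "ppi_MDS n P k C \<longleftrightarrow> singleton_equality n P k (min_dist (ppi_dist n P k) C - 1) C"

end

theory Submission
  imports Defs "Berlekamp_Zassenhaus.Berlekamp_Type_Based"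
begin

text \<open>Each element of \<open>I\<^sub>x\<close> contributes at most \<open>M\<^sub>w\<close> to the \<open>(P, w, \<pi>)\<close>-weight, so the two minimum
  distances satisfy \<open>d\<^sub>w \<le> d M\<^sub>w\<close> and hence \<open>r = \<lfloor>(d\<^sub>w - 1) / M\<^sub>w\<rfloor> \<le> d - 1\<close>. Every ideal of cardinality
  \<open>r\<close> extends to one of cardinality \<open>d - 1\<close>, so the left side of the MDS condition only grows when
  passing from \<open>r\<close> to \<open>d - 1\<close>. It cannot exceed the right side by the Singleton bound for the
  \<open>(P, \<pi>)\<close>-metric.\<close>

section \<open>Extending ideals to a prescribed cardinality\<close>

text \<open>Adjoining a minimal element of the complement keeps an ideal an ideal.\<close>

lemma ideal_extend_one:
  assumes po: "partial_order_on {1..n} P" and J: "poset_ideal n P J" and less: "card J < n"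
  obtains m where "m \<notin> J" "poset_ideal n P (insert m J)"
proof -
  have JS: "J \<subseteq> {1..n}"
    using J by (auto simp: poset_ideal_def)
  have PS: "P \<subseteq> {1..n} \<times> {1..n}" and tr: "trans P" and an: "antisym P"
    using po by (auto simp: partial_order_on_def preorder_on_def)
  have ne: "{1..n} - J \<noteq> {}"
  proof
    assume "{1..n} - J = {}"
    with JS have "J = {1..n}"
      by blast
    with less show False
      by simp
  qed
  \<comment> \<open>The strict part of a finite order is acyclic, hence well-founded, so the
    nonempty complement of \<open>J\<close> has a minimal element.\<close>
  have "acyclic (P - Id)"
    using tr an by (simp add: acyclic_def trancl_id trans_diff_Id)
  moreover have "finite (P - Id)"
    by (rule finite_subset[of _ "{1..n} \<times> {1..n}"]) (use PS in auto)
  ultimately have "wf (P - Id)"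
    by (simp add: finite_acyclic_wf)
  from this ne obtain m where m: "m \<in> {1..n} - J" "\<And>y. (y, m) \<in> P - Id \<Longrightarrow> y \<notin> {1..n} - J"
    by (rule wfE_min') blast
  have "poset_ideal n P (insert m J)"
    unfolding poset_ideal_def
  proof (intro conjI ballI allI impI)
    show "insert m J \<subseteq> {1..n}"
      using JS m(1) by blast
  next
    fix j i
    assume "j \<in> insert m J" and ij: "(i, j) \<in> P"
    \<comment> \<open>Whatever lies strictly below \<open>m\<close> is already in \<open>J\<close>
      by minimality of \<open>m\<close>, so only \<open>m\<close> itself is new.\<close>
    then consider "j \<in> J" | "j = m" "i = m" | "j = m" "(i, m) \<in> P - Id"
      by blast
    then show "i \<in> insert m J"
      using J ij m(2)[of i] PS by cases (auto simp: poset_ideal_def)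
  qed
  with m that show thesis
    by blast
qed

lemma ideal_extend:
  assumes po: "partial_order_on {1..n} P" and "poset_ideal n P J" and "card J \<le> s" and "s \<le> n"
  obtains J' where "J \<subseteq> J'" "J' \<in> ideals_of_card n P s"
proof -
  have "\<exists>J'. J \<subseteq> J' \<and> J' \<in> ideals_of_card n P s"
    using assms(3,4)
  proof (induction s rule: dec_induct)
    case base
    then show ?case
      using assms(2) by (auto simp: ideals_of_card_def)
  next
    case (step s)
    then obtain J' where J': "J \<subseteq> J'" "poset_ideal n P J'" "card J' = s"
      by (auto simp: ideals_of_card_def)
    obtain m where m: "m \<notin> J'" "poset_ideal n P (insert m J')"
      using ideal_extend_one[OF po J'(2)] J'(3) step.prems by auto
    have "finite J'"
      using J'(2) by (auto simp: poset_ideal_def intro: finite_subset)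
    then show ?case
      using J' m by (intro exI[of _ "insert m J'"]) (auto simp: ideals_of_card_def)
  qed
  then show thesis
    using that by blast
qed

lemma finite_ideals_of_card: "finite (ideals_of_card n P r)"
  by (rule finite_subset[of _ "Pow {1..n}"]) (auto simp: ideals_of_card_def poset_ideal_def)

text \<open>The empty ideal extends to every size up to \<open>n\<close>; this keeps
  \<open>Max\<close> over the ideals of a given size meaningful.\<close>

lemma ideals_of_card_nonempty:
  assumes "partial_order_on {1..n} P" and "r \<le> n"
  shows "ideals_of_card n P r \<noteq> {}"
  using ideal_extend[OF assms(1), of "{}" r] assms(2) by (auto simp: poset_ideal_def)

text \<open>An ideal of size \<open>r\<close> sits inside one of size \<open>s\<close>, and labels
  are nonnegative, so the larger sum dominates.\<close>

lemma Max_label_sum_mono: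
  fixes k :: "nat \<Rightarrow> nat"
  assumes po: "partial_order_on {1..n} P" and "r \<le> s" and "s \<le> n"
  shows "Max ((\<lambda>J. \<Sum>i\<in>J. k i) ` ideals_of_card n P r)
           \<le> Max ((\<lambda>J. \<Sum>i\<in>J. k i) ` ideals_of_card n P s)"
proof (rule Max.boundedI)
  fix a
  assume "a \<in> (\<lambda>J. \<Sum>i\<in>J. k i) ` ideals_of_card n P r"
  then obtain J where J: "poset_ideal n P J" "card J = r" and a: "a = (\<Sum>i\<in>J. k i)"
    by (auto simp: ideals_of_card_def)
  obtain J' where J': "J \<subseteq> J'" "J' \<in> ideals_of_card n P s"
    using ideal_extend[OF po J(1)] J(2) assms(2,3) by metis
  have "finite J'"
    using J'(2) by (auto simp: ideals_of_card_def poset_ideal_def intro: finite_subset)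
  then have "a \<le> (\<Sum>i\<in>J'. k i)"
    unfolding a using J'(1) by (simp add: sum_mono2)
  also have "\<dots> \<le> Max ((\<lambda>J. \<Sum>i\<in>J. k i) ` ideals_of_card n P s)"
    using J'(2) finite_ideals_of_card by (intro Max_ge) auto
  finally show "a \<le> Max ((\<lambda>J. \<Sum>i\<in>J. k i) ` ideals_of_card n P s)" .
qed (use assms ideals_of_card_nonempty[OF po, of r] in \<open>auto simp: finite_ideals_of_card\<close>)

section \<open>Ideals generated by supports\<close>

text \<open>The hull is an intersection of ideals. The family is nonempty because it contains
  \<open>{1..n}\<close>, which keeps the intersection inside \<open>{1..n}\<close>.\<close>

lemma poset_ideal_supp_ideal:
  assumes "partial_order_on {1..n} P"
  shows "poset_ideal n P (supp_ideal n P k x)"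
proof -
  have "poset_ideal n P {1..n}"
    using assms by (auto simp: poset_ideal_def partial_order_on_def preorder_on_def)
  moreover have "block_supp n k x \<subseteq> {1..n}"
    by (auto simp: block_supp_def)
  ultimately show ?thesis
    unfolding supp_ideal_def hull_def poset_ideal_def by blast
qed

lemma block_supp_subset_supp_ideal: "block_supp n k x \<subseteq> supp_ideal n P k x"
  by (simp add: supp_ideal_def hull_subset)

lemma supp_ideal_minimal:
  assumes "poset_ideal n P J" and "block_supp n k x \<subseteq> J"
  shows "supp_ideal n P k x \<subseteq> J"
  using assms by (simp add: supp_ideal_def hull_minimal)

lemma finite_supp_ideal:
  assumes "partial_order_on {1..n} P"
  shows "finite (supp_ideal n P k x)"
  using poset_ideal_supp_ideal[OF assms, of k x]
  by (auto simp: poset_ideal_def intro: finite_subset)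

section \<open>Comparison of the two weights\<close>

lemma max_weight_pos:
  assumes "is_weight w"
  shows "0 < max_weight w"
proof -
  have "0 < w 1"
    using assms by (metis is_weight_def neq0_conv zero_neq_one)
  also have "w 1 \<le> max_weight w"
    by (simp add: max_weight_def)
  finally show ?thesis .
qed

lemma block_weight_le_max_weight:
  assumes "0 < dim_vec v"
  shows "block_weight w v \<le> max_weight w"
  using assms unfolding block_weight_def
  by (intro Max.boundedI) (auto simp: max_weight_def)

text \<open>A maximal element of the ideal contributes at most \<open>max_weight w\<close>, every
  other element exactly that much. Positive dimensions are required because
  \<open>block_weight\<close> of an empty block is a \<open>Max\<close> over the empty set.\<close>

lemma pwpi_weight_le:
  assumes po: "partial_order_on {1..n} P" and dim: "\<And>i. i \<in> {1..n} \<Longrightarrow> 0 < dim_vec (x i)"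
  shows "pwpi_weight n P w k x \<le> ppi_weight n P k x * max_weight w"
proof -
  define I where "I = supp_ideal n P k x"
  define M where "M = maximal_elements P I"
  have fin: "finite I" and MI: "M \<subseteq> I" and sub: "I \<subseteq> {1..n}"
    using finite_supp_ideal[OF po, of k x] poset_ideal_supp_ideal[OF po, of k x]
    by (auto simp: I_def M_def maximal_elements_def poset_ideal_def)
  have "block_weight w (x i) \<le> max_weight w" if "i \<in> M" for i
    using that MI sub by (intro block_weight_le_max_weight dim) blast
  then have "(\<Sum>i\<in>M. block_weight w (x i)) \<le> card M * max_weight w"
    by (rule sum_bounded_above[where K = "max_weight w", unfolded of_nat_id])
  then have "pwpi_weight n P w k x \<le> (card M + card (I - M)) * max_weight w"
    by (simp add: pwpi_weight_def Let_def add_mult_distrib flip: I_def M_def)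
  also have "card M + card (I - M) = card I"
    using fin MI by (metis card_Diff_subset card_mono finite_subset le_add_diff_inverse)
  finally show ?thesis
    by (simp add: ppi_weight_def I_def)
qed

section \<open>Minimum distances and distances between block vectors\<close>

lemma min_dist_le:
  assumes "finite C" and "x \<in> C" and "y \<in> C" and "x \<noteq> y"
  shows "min_dist d C \<le> d x y"
proof -
  have "finite {d x y | x y. x \<in> C \<and> y \<in> C \<and> x \<noteq> y}"
    by (rule finite_subset[of _ "(\<lambda>(x, y). d x y) ` (C \<times> C)"]) (use assms(1) in auto)
  then show ?thesis
    unfolding min_dist_def using assms by (intro Min_le) auto
qed

lemma min_dist_attained:
  assumes "2 \<le> card C"
  obtains x y where "x \<in> C" "y \<in> C" "x \<noteq> y" "min_dist d C = d x y"
proof -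
  let ?D = "{d x y | x y. x \<in> C \<and> y \<in> C \<and> x \<noteq> y}"
  have fin: "finite C"
    using assms by (metis card.infinite not_numeral_le_zero)
  have "finite ?D"
    by (rule finite_subset[of _ "(\<lambda>(x, y). d x y) ` (C \<times> C)"]) (use fin in auto)
  moreover have "?D \<noteq> {}"
  proof -
    have "\<not> card C \<le> Suc 0"
      using assms by simp
    then obtain x y where "x \<in> C" "y \<in> C" "x \<noteq> y"
      unfolding card_le_Suc0_iff_eq[OF fin] by blast
    then show ?thesis
      by auto
  qed
  ultimately have "Min ?D \<in> ?D"
    by (rule Min_in)
  then have "\<exists>x y. min_dist d C = d x y \<and> x \<in> C \<and> y \<in> C \<and> x \<noteq> y"
    unfolding min_dist_def by (rule CollectD)
  then show thesis
    by (elim exE conjE) (rule that)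
qed

lemma block_supp_block_diff:
  assumes "x \<in> block_space n k" and "y \<in> block_space n k"
  shows "block_supp n k (block_diff n x y) = {i \<in> {1..n}. x i \<noteq> y i}"
proof -
  have "x i - y i = 0\<^sub>v (k i) \<longleftrightarrow> x i = y i" if "i \<in> {1..n}" for i
  proof -
    have "x i \<in> carrier_vec (k i)" "y i \<in> carrier_vec (k i)"
      using assms that by (auto simp: block_space_def)
    then show ?thesis
      by (auto simp: vec_eq_iff)
  qed
  then show ?thesis
    by (auto simp: block_supp_def block_diff_def)
qed

lemma ppi_dist_pos:
  assumes po: "partial_order_on {1..n} P"
    and xy: "x \<in> block_space n k" "y \<in> block_space n k" "x \<noteq> y"
  shows "0 < ppi_dist n P k x y"
proof -
  obtain i where "i \<in> {1..n}" "x i \<noteq> y i"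
    using xy PiE_ext[of x "{1..n}" "\<lambda>i. carrier_vec (k i)" y] unfolding block_space_def by blast
  then have "i \<in> supp_ideal n P k (block_diff n x y)"
    using block_supp_subset_supp_ideal[of n k "block_diff n x y" P]
    by (auto simp: block_supp_block_diff[OF xy(1,2)])
  then show ?thesis
    using finite_supp_ideal[OF po] by (auto simp: ppi_dist_def ppi_weight_def card_gt_0_iff)
qed

text \<open>The support of the difference lies in \<open>J\<close>, and so does the ideal it
  generates.\<close>

lemma ppi_dist_le_card_ideal:
  assumes J: "poset_ideal n P J"
    and xy: "x \<in> block_space n k" "y \<in> block_space n k"
    and eq: "\<And>i. i \<in> {1..n} - J \<Longrightarrow> x i = y i"
  shows "ppi_dist n P k x y \<le> card J"
proof -
  have "supp_ideal n P k (block_diff n x y) \<subseteq> J"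
    using eq by (intro supp_ideal_minimal[OF J]) (auto simp: block_supp_block_diff[OF xy])
  moreover have "finite J"
    using J by (auto simp: poset_ideal_def intro: finite_subset)
  ultimately show ?thesis
    by (simp add: ppi_dist_def ppi_weight_def card_mono)
qed

section \<open>The Singleton bound for the poset block metric\<close>

text \<open>Deleting the blocks in an ideal of cardinality below the minimum distance is injective
  on the code.\<close>

lemma card_code_le:
  fixes C :: "(nat \<Rightarrow> 'a :: {field, finite} vec) set"
  assumes CS: "C \<subseteq> block_space n k" and fin: "finite C"
    and J: "poset_ideal n P J" and less: "card J < min_dist (ppi_dist n P k) C"
  shows "card C \<le> CARD('a) ^ (\<Sum>i\<in>{1..n} - J. k i)"
proof -
  let ?K = "{1..n} - J"
  let ?T = "(\<Pi>\<^sub>E i\<in>?K. carrier_vec (k i)) :: (nat \<Rightarrow> 'a vec) set"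
  have inj: "inj_on (\<lambda>x. restrict x ?K) C"
  proof (rule inj_onI, rule ccontr)
    fix x y
    assume xy: "x \<in> C" "y \<in> C" and eq: "restrict x ?K = restrict y ?K" and ne: "x \<noteq> y"
    \<comment> \<open>Two codewords that agree outside \<open>J\<close> are at distance at most
      \<open>card J\<close>, which is below the minimum distance.\<close>
    have "x i = y i" if "i \<in> ?K" for i
      using fun_cong[OF eq, of i] that by simp
    then have "ppi_dist n P k x y \<le> card J"
      using xy CS by (intro ppi_dist_le_card_ideal[OF J]) auto
    with less min_dist_le[OF fin xy ne, of "ppi_dist n P k"] show False
      by simp
  qed
  have sub: "(\<lambda>x. restrict x ?K) ` C \<subseteq> ?T"
    using CS by (auto simp: block_space_def dest!: subsetD)
  have "finite ?T"
    by (intro finite_PiE) auto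
  with inj sub have "card C \<le> card ?T"
    by (rule card_inj_on_le)
  also have "card ?T = CARD('a) ^ (\<Sum>i\<in>?K. k i)"
    by (simp add: card_PiE card_carrier_vec power_sum)
  finally show ?thesis .
qed

text \<open>For an ideal \<open>J\<close> with the largest label sum, deleting its blocks embeds the
  code into a space of dimension \<open>e\<close>, the label sum over the complement of
  \<open>J\<close>. Taking logarithms gives the bound.\<close>

lemma singleton_bound:
  fixes C :: "(nat \<Rightarrow> 'a :: {field, finite} vec) set"
  assumes po: "partial_order_on {1..n} P" and CS: "C \<subseteq> block_space n k" and card: "2 \<le> card C"
    and s: "s < min_dist (ppi_dist n P k) C" "s \<le> n"
  shows "int (Max ((\<lambda>J. \<Sum>i\<in>J. k i) ` ideals_of_card n P s))
           \<le> int (\<Sum>i = 1..n. k i) - \<lceil>log (real CARD('a)) (real (card C))\<rceil>"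
proof -
  let ?q = "CARD('a)"
  have q: "1 < real ?q"
    using card_mono[of UNIV "{0, 1 :: 'a}"] by simp
  have fin: "finite C"
    using card by (metis card.infinite not_numeral_le_zero)
  have "Max ((\<lambda>J. \<Sum>i\<in>J. k i) ` ideals_of_card n P s) \<in> (\<lambda>J. \<Sum>i\<in>J. k i) ` ideals_of_card n P s"
    using ideals_of_card_nonempty[OF po s(2)] finite_ideals_of_card by (intro Max_in) auto
  then obtain J where J: "poset_ideal n P J" "card J = s"
    and Max: "Max ((\<lambda>J. \<Sum>i\<in>J. k i) ` ideals_of_card n P s) = (\<Sum>i\<in>J. k i)"
    by (auto simp: ideals_of_card_def)
  define e where "e = (\<Sum>i\<in>{1..n} - J. k i)"
  have "real (card C) \<le> real ?q ^ e"
    using card_code_le[OF CS fin J(1)] J(2) s(1)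
    by (metis e_def of_nat_le_iff of_nat_power)
  then have "log (real ?q) (real (card C)) \<le> real e"
    using q card by (intro log_of_power_le) auto
  then have "\<lceil>log (real ?q) (real (card C))\<rceil> \<le> int e"
    by (simp add: ceiling_le_iff)
  moreover have "(\<Sum>i = 1..n. k i) = e + (\<Sum>i\<in>J. k i)"
    unfolding e_def using J(1) by (intro sum.subset_diff) (auto simp: poset_ideal_def)
  ultimately show ?thesis
    unfolding Max by simp
qed

section \<open>Passing from one MDS condition to the other\<close>

theorem theorem4p3:
  fixes n :: nat
    and P :: "(nat \<times> nat) set"
    and w :: "'a :: {field, finite} \<Rightarrow> nat"
    and k :: "nat \<Rightarrow> nat"
    and C :: "(nat \<Rightarrow> 'a vec) set"
  assumes "partial_order_on {1..n} P"
    and "is_weight w"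
    and "\<And>i. i \<in> {1..n} \<Longrightarrow> k i > 0"
    and "C \<subseteq> block_space n k"
    and "card C \<ge> 2"
    and "pwpi_MDS n P w k C"
  shows "ppi_MDS n P k C"
proof -
  note po = assms(1) and CS = assms(4)
  let ?M = "max_weight w"
  define dw where "dw = min_dist (pwpi_dist n P w k) C"
  define d where "d = min_dist (ppi_dist n P k) C"
  define r where "r = (dw - 1) div ?M"
  have fin: "finite C"
    using assms(5) by (metis card.infinite not_numeral_le_zero)
  obtain x y where xy: "x \<in> C" "y \<in> C" "x \<noteq> y" and d_eq: "d = ppi_dist n P k x y"
    unfolding d_def using min_dist_attained[OF assms(5)] by metis
  have xyS: "x \<in> block_space n k" "y \<in> block_space n k"
    using xy CS by auto
  have d_pos: "0 < d"
    using ppi_dist_pos[OF po xyS xy(3)] d_eq by simp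
  \<comment> \<open>This guarantees that ideals of cardinality \<open>d - 1\<close> exist.\<close>
  have "d \<le> n"
    using poset_ideal_supp_ideal[OF po, of k "block_diff n x y"]
      card_mono[of "{1..n}" "supp_ideal n P k (block_diff n x y)"]
    by (simp add: d_eq ppi_dist_def ppi_weight_def poset_ideal_def)
  have dim: "0 < dim_vec (block_diff n x y i)" if "i \<in> {1..n}" for i
  proof -
    have "y i \<in> carrier_vec (k i)"
      using that xyS(2) by (auto simp: block_space_def)
    then show ?thesis
      using that assms(3)[OF that] by (simp add: block_diff_def)
  qed
  have "dw \<le> pwpi_dist n P w k x y"
    unfolding dw_def by (rule min_dist_le[OF fin xy])
  also have "\<dots> \<le> d * ?M"
    using pwpi_weight_le[OF po dim] by (simp add: d_eq pwpi_dist_def ppi_dist_def)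
  \<comment> \<open>Positivity of \<open>d * ?M\<close> makes the inequality strict, also for
    \<open>dw = 0\<close>, where the subtraction truncates. Strictness is what yields
    \<open>r < d\<close> after the division.\<close>
  finally have "dw - 1 < d * ?M"
    using d_pos max_weight_pos[OF assms(2)] by (cases dw) auto
  then have "r < d"
    unfolding r_def by (rule less_mult_imp_div_less)
  then have "r \<le> d - 1"
    by simp
  then have "Max ((\<lambda>J. \<Sum>i\<in>J. k i) ` ideals_of_card n P r)
               \<le> Max ((\<lambda>J. \<Sum>i\<in>J. k i) ` ideals_of_card n P (d - 1))"
    using \<open>d \<le> n\<close> by (intro Max_label_sum_mono[OF po]) auto
  moreover have "int (Max ((\<lambda>J. \<Sum>i\<in>J. k i) ` ideals_of_card n P (d - 1)))
           \<le> int (\<Sum>i = 1..n. k i) - \<lceil>log (real CARD('a)) (real (card C))\<rceil>"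
    using d_pos \<open>d \<le> n\<close> by (intro singleton_bound[OF po CS assms(5)]) (auto simp: d_def)
  \<comment> \<open>By the MDS hypothesis the maximum for \<open>r\<close> equals the right side, so
    the maximum for \<open>d - 1\<close> is squeezed between equal numbers.\<close>
  ultimately show ?thesis
    using assms(6)
    unfolding ppi_MDS_def pwpi_MDS_def singleton_equality_def d_def dw_def r_def
    by linarith
qed

end
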